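(* Let $X$ be a separable Fréchet space and let $T$ be a continuous linear operator on $X$. Suppose that there are a dense subset $X_0$ of $X$ and a map $S:X_0\to X_0$ such that, for every $x\in X_0$, (i) $\sum_{n=0}^{\infty}T^nx$ converges unconditionally, (ii) $\sum_{n=0}^{\infty}S^nx$ converges unconditionally, (iii) $TSx=x$. Then $T$ is $\widetilde{B}_s$-frequently hypercyclic for every integer $s\ge2$.
   Context: $\mathbb{N}$ is the set of positive integers. For a non-negative sequence $(\alpha_k)_{k\ge1}$ with $\sum_{k}\alpha_k=+\infty$, the associated admissible matrix is $A=(\alpha_k/\sum_{j=1}^n\alpha_j)$, i.e. the infinite matrix $(\alpha_{n,k})$ with $\alpha_{n,k}=\alpha_k/\sum_{j=1}^n\alpha_j$ for $1\le k\le n$ and $\alpha_{n,k}=0$ for $k>n$. The lower $A$-density of $E\subset\mathbb{N}$ is $$\underline{d}_A(E)=\liminf_{n\to+\infty}\frac{\sum_{k\le n,\,k\in E}\alpha_k}{\sum_{j=1}^n\alpha_j}.$$ For an integer $s\ge2$, let $\log^{(s)}=\log\circ\log\circ\cdots\circ\log$ ($\log$ appearing $s$ times) and $h_s=\log\cdot\log^{(s)}$ (product of functions). $\widetilde{B}_s$ is the admissible matrix associated with a sequence of non-negative weights such that $\alpha_k=e^{k/h_s(k)}$ for all $k$ large enough (the finitely many other values are irrelevant). A continuous linear operator $T$ on $X$ is $A$-frequently hypercyclic if there is $x\in X$ such that for every non-empty open set $U\subset X$, the set $N(x,U)=\{n\in\mathbb{N}:T^nx\in U\}$ satisfies $\underline{d}_A(N(x,U))>0$.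 *)

theory Defs
  imports "HOL-Analysis.Analysis"
begin

section \<open>Frechet spaces\<close>

definition seminorm :: "('k::real_normed_field \<Rightarrow> 'a::ab_group_add \<Rightarrow> 'a) \<Rightarrow> ('a \<Rightarrow> real) \<Rightarrow> bool"
  where "seminorm smul p \<longleftrightarrow>
    (\<forall>x. 0 \<le> p x) \<and>
    (\<forall>x y. p (x + y) \<le> p x + p y) \<and>
    (\<forall>c x. p (smul c x) = norm c * p x)"

text \<open>
  By the Gelfand-Mazur theorem the fields of class \<^class>\<open>real_normed_field\<close> are, up to isometric
  isomorphism, exactly the reals and the complex numbers, so both the real and the complex
  Frechet spaces are covered. The vector space is the whole type \<open>'a\<close> with the scalar
  multiplication \<open>smul\<close>; its topology, given by the type class, is required to be the one
  induced by a separating sequence of seminorms.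
\<close>

definition frechet_space ::
    "('k::real_normed_field \<Rightarrow> 'a::{ab_group_add, topological_space} \<Rightarrow> 'a) \<Rightarrow> bool"
  where "frechet_space smul \<longleftrightarrow>
    vector_space smul \<and>
    (\<exists>p :: nat \<Rightarrow> 'a \<Rightarrow> real.
      (\<forall>i. seminorm smul (p i)) \<and>
      (\<forall>x. (\<forall>i. p i x = 0) \<longrightarrow> x = 0) \<and>
      (\<forall>U. open U \<longleftrightarrow>
        (\<forall>x\<in>U. \<exists>N. \<exists>e>0. \<forall>y. (\<forall>i\<le>N. p i (y - x) < e) \<longrightarrow> y \<in> U)) \<and>
      (\<forall>X :: nat \<Rightarrow> 'a.
        (\<forall>i. \<forall>e>0. \<exists>M. \<forall>m\<ge>M. \<forall>n\<ge>M. p i (X m - X n) < e) \<longrightarrow> convergent X))"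

section \<open>Admissible matrices and densities\<close>

text \<open>
  Sequences and matrices are indexed by the positive integers: the values at index \<open>0\<close> are
  never used.
\<close>

definition admissible_weights :: "(nat \<Rightarrow> real) \<Rightarrow> bool"
  where "admissible_weights \<alpha> \<longleftrightarrow>
    (\<forall>k\<ge>1. 0 \<le> \<alpha> k) \<and> filterlim (\<lambda>n. \<Sum>k=1..n. \<alpha> k) at_top sequentially"

definition admissible_matrix :: "(nat \<Rightarrow> real) \<Rightarrow> nat \<Rightarrow> nat \<Rightarrow> real"
  where "admissible_matrix \<alpha> n k =
    (if 1 \<le> k \<and> k \<le> n then \<alpha> k / (\<Sum>j=1..n. \<alpha> j) else 0)"

text \<open>The inferior limit is taken in the extended reals, where it always exists.\<close>

definition lower_density :: "(nat \<Rightarrow> nat \<Rightarrow> real) \<Rightarrow> nat set \<Rightarrow> ereal"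
  where "lower_density A E = liminf (\<lambda>n. ereal (\<Sum>k\<in>{1..n} \<inter> E. A n k))"

lemma lower_density_admissible_matrix:
  "lower_density (admissible_matrix \<alpha>) E =
    liminf (\<lambda>n. ereal ((\<Sum>k\<in>{1..n} \<inter> E. \<alpha> k) / (\<Sum>j=1..n. \<alpha> j)))"
proof -
  have "(\<Sum>k\<in>{1..n} \<inter> E. admissible_matrix \<alpha> n k) =
      (\<Sum>k\<in>{1..n} \<inter> E. \<alpha> k) / (\<Sum>j=1..n. \<alpha> j)" for n
    by (auto simp: admissible_matrix_def sum_divide_distrib intro!: sum.cong)
  then show ?thesis
    by (simp add: lower_density_def)
qed

definition h_fun :: "nat \<Rightarrow> real \<Rightarrow> real"
  where "h_fun s x = ln x * (ln ^^ s) x"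

text \<open>
  The admissible matrices of every sequence of weights with the prescribed tail; there is no
  canonical choice of the finitely many remaining weights.
\<close>

definition is_B_tilde :: "nat \<Rightarrow> (nat \<Rightarrow> nat \<Rightarrow> real) \<Rightarrow> bool"
  where "is_B_tilde s B \<longleftrightarrow>
    (\<exists>\<alpha>. admissible_weights \<alpha> \<and>
      (\<forall>\<^sub>F k in sequentially. \<alpha> k = exp (real k / h_fun s (real k))) \<and>
      B = admissible_matrix \<alpha>)"

section \<open>Frequent hypercyclicity with respect to a matrix\<close>

definition frequently_hypercyclic ::
    "(nat \<Rightarrow> nat \<Rightarrow> real) \<Rightarrow> ('a::topological_space \<Rightarrow> 'a) \<Rightarrow> bool"
  where "frequently_hypercyclic A T \<longleftrightarrow>
    (\<exists>x. \<forall>U. open U \<and> U \<noteq> {} \<longrightarrow> lower_density A {n. n \<ge> 1 \<and> (T ^^ n) x \<in> U} > 0)"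

end

theory Submission
  imports Defs
begin

text \<open>
  The weights \<open>exp (k / h k)\<close> with \<open>h = h_fun s\<close> change by a factor bounded away from \<open>1\<close> and
  from infinity over windows of length comparable to \<open>h k\<close>. So a positive proportion of the mass
  up to \<open>n\<close> lies in the last few windows before \<open>n\<close>, and a set has positive lower density as soon
  as, for some fixed number, it fills a fixed proportion of one window among any that many
  consecutive ones. Since \<open>h\<close> tends to infinity, the windows eventually leave room for gaps of any
  prescribed size. Reserving window number \<open>j\<close> for the type given by the 2-adic valuation of
  \<open>j + 1\<close>, one obtains, for any prescribed distances \<open>N l\<close>, disjoint sets of positive lower density
  such that the elements of the set number \<open>l\<close> are at distance at least \<open>N l\<close> from all other
  elements of all these sets: this is \<open>separated_sets_for_slowly_growing\<close>. The only properties of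
  \<open>h\<close> that enter are collected in \<open>slowly_growing\<close>, with exponent \<open>1 / 2\<close>.

  Given such sets, the usual argument for the Frequent Hypercyclicity Criterion applies. Choose
  points \<open>x l\<close> of \<open>X0\<close> that are dense, and let \<open>z\<close> be the sum of \<open>(S ^^ m) (x l)\<close> over all \<open>l\<close> and
  all \<open>m\<close> in the set number \<open>l\<close>. If \<open>n\<close> belongs to the set number \<open>l\<close>, then \<open>(T ^^ n) z\<close> is \<open>x l\<close>
  plus terms \<open>(T ^^ k) (x \<mu>)\<close> and \<open>(S ^^ k) (x \<mu>)\<close> in which \<open>k\<close> is at least \<open>N l\<close> and \<open>N \<mu>\<close>; by
  unconditional convergence their sum is small if \<open>N\<close> grows fast enough
  (\<open>orbit_follows_pattern\<close>). So \<open>(T ^^ n) z\<close> is close to \<open>x l\<close> for all \<open>n\<close> in a set of positive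
  lower density.
\<close>

section \<open>Slowly growing functions\<close>

text \<open>
  A quantitative form of slow growth: \<open>f\<close> tends to infinity and, from some point on, is
  nondecreasing while \<open>f x / x powr d\<close> is nonincreasing. Phrasing the two conditions as a
  comparison of \<open>f x\<close> and \<open>f y\<close> avoids derivatives of the iterated logarithms.
\<close>

definition slowly_growing :: "real \<Rightarrow> (real \<Rightarrow> real) \<Rightarrow> bool"
  where "slowly_growing d f \<longleftrightarrow> filterlim f at_top at_top \<and>
    (\<forall>\<^sub>F x in at_top. \<forall>y\<ge>x. f x \<le> f y \<and> f y \<le> f x * (y / x) powr d)"

lemma slowly_growing_id: "slowly_growing 1 (\<lambda>x. x)"
  unfolding slowly_growing_def
proof
  show "\<forall>\<^sub>F x::real in at_top. \<forall>y\<ge>x. x \<le> y \<and> y \<le> x * (y / x) powr 1"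
    using eventually_gt_at_top[of 0] by eventually_elim auto
qed (rule filterlim_ident)

text \<open>
  One logarithm turns any polynomial bound into an arbitrarily slow one. If
  \<open>f y \<le> f x * (y / x) powr d\<close>, then \<open>ln (f y) \<le> ln (f x) + d * ln (y / x)\<close>; as soon as
  \<open>d \<le> e * ln (f x)\<close>, this is at most \<open>ln (f x) * (1 + e * ln (y / x))\<close>, and
  \<open>1 + u \<le> exp u\<close> finishes the estimate.
\<close>

lemma slowly_growing_ln:
  assumes f: "slowly_growing d f" and "0 \<le> d" and e: "0 < e"
  shows "slowly_growing e (\<lambda>x. ln (f x))"
  unfolding slowly_growing_def
proof
  have lim: "filterlim f at_top at_top"
    using f by (simp add: slowly_growing_def)
  then show lnlim: "filterlim (\<lambda>x. ln (f x)) at_top at_top"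
    by (rule filterlim_compose[OF ln_at_top])
  have "\<forall>\<^sub>F x in at_top. 1 \<le> f x" "\<forall>\<^sub>F x in at_top. 1 + d / e \<le> ln (f x)"
    using lim lnlim by (auto simp: filterlim_at_top)
  moreover have "\<forall>\<^sub>F x in at_top. \<forall>y\<ge>x. f x \<le> f y \<and> f y \<le> f x * (y / x) powr d"
    using f by (simp add: slowly_growing_def)
  ultimately show "\<forall>\<^sub>F x in at_top. \<forall>y\<ge>x. ln (f x) \<le> ln (f y) \<and>
      ln (f y) \<le> ln (f x) * (y / x) powr e"
    using eventually_gt_at_top[of 0]
  proof eventually_elim
    case (elim x)
    show ?case
    proof (intro allI impI)
      fix y assume "x \<le> y"
      define r where "r = ln (y / x)"
      have r: "0 \<le> r" and xy: "0 < y / x"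
        using elim \<open>x \<le> y\<close> by (auto simp: r_def)
      have fxy: "f x \<le> f y" "f y \<le> f x * (y / x) powr d"
        using elim \<open>x \<le> y\<close> by auto
      have "ln (f y) \<le> ln (f x * (y / x) powr d)"
        using fxy elim xy by (subst ln_le_cancel_iff) auto
      also have "\<dots> = ln (f x) + d * r"
        using elim xy \<open>x \<le> y\<close> by (simp add: ln_mult r_def)
      also have "\<dots> \<le> ln (f x) + (ln (f x) * e) * r"
      proof -
        have "d / e \<le> ln (f x)" using elim by simp
        then have "d \<le> ln (f x) * e" using e by (simp add: pos_divide_le_eq)
        then show ?thesis using r by (simp add: mult_right_mono)
      qed
      also have "\<dots> = ln (f x) * (1 + e * r)"
        by (simp add: algebra_simps)
      also have "\<dots> \<le> ln (f x) * (y / x) powr e"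
      proof (rule mult_left_mono)
        show "1 + e * r \<le> (y / x) powr e"
          using exp_ge_add_one_self[of "e * r"] xy by (auto simp: powr_def r_def)
        show "0 \<le> ln (f x)" using elim by simp
      qed
      finally show "ln (f x) \<le> ln (f y) \<and> ln (f y) \<le> ln (f x) * (y / x) powr e"
        using fxy elim by auto
    qed
  qed
qed

lemma slowly_growing_mult:
  assumes f: "slowly_growing d f" and g: "slowly_growing e g"
  shows "slowly_growing (d + e) (\<lambda>x. f x * g x)"
  unfolding slowly_growing_def
proof
  have lim: "filterlim f at_top at_top" "filterlim g at_top at_top"
    using f g by (simp_all add: slowly_growing_def)
  then show "filterlim (\<lambda>x. f x * g x) at_top at_top"
    by (rule filterlim_at_top_mult_at_top)
  have "\<forall>\<^sub>F x in at_top. 0 \<le> f x" "\<forall>\<^sub>F x in at_top. 0 \<le> g x"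
    using lim by (auto simp: filterlim_at_top)
  moreover have "\<forall>\<^sub>F x in at_top. \<forall>y\<ge>x. f x \<le> f y \<and> f y \<le> f x * (y / x) powr d"
    "\<forall>\<^sub>F x in at_top. \<forall>y\<ge>x. g x \<le> g y \<and> g y \<le> g x * (y / x) powr e"
    using f g by (simp_all add: slowly_growing_def)
  ultimately show "\<forall>\<^sub>F x in at_top. \<forall>y\<ge>x. f x * g x \<le> f y * g y \<and>
      f y * g y \<le> f x * g x * (y / x) powr (d + e)"
  proof eventually_elim
    case (elim x)
    show ?case
    proof (intro allI impI conjI)
      fix y assume "x \<le> y"
      then have fg: "f x \<le> f y" "f y \<le> f x * (y / x) powr d"
          "g x \<le> g y" "g y \<le> g x * (y / x) powr e"
        using elim by auto
      show "f x * g x \<le> f y * g y"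
        using fg elim by (intro mult_mono) auto
      have "f y * g y \<le> (f x * (y / x) powr d) * (g x * (y / x) powr e)"
        using fg elim by (intro mult_mono) auto
      then show "f y * g y \<le> f x * g x * (y / x) powr (d + e)"
        by (simp add: powr_add mult_ac)
    qed
  qed
qed

lemma slowly_growing_h_fun:
  assumes "1 \<le> s"
  shows "slowly_growing (1 / 2) (h_fun s)"
proof -
  have "\<forall>e>0. slowly_growing e (ln ^^ Suc n)" for n
  proof (induction n)
    case 0
    show ?case
      using slowly_growing_ln[OF slowly_growing_id] by (simp add: o_def)
  next
    case (Suc n)
    then have "slowly_growing 1 (ln ^^ Suc n)"
      using zero_less_one by blast
    from slowly_growing_ln[OF this] show ?case
      by (simp add: o_def)
  qed
  from this[of 0] this[of "s - 1"] assms
  have "slowly_growing (1 / 4) ln" "slowly_growing (1 / 4) (ln ^^ s)"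
    by simp_all
  from slowly_growing_mult[OF this] show ?thesis
    by (simp add: h_fun_def[abs_def])
qed

lemma slowly_growing_sublinear:
  assumes h: "slowly_growing (1 / 2) h"
  shows "\<forall>\<^sub>F x in at_top. h x \<le> x / 2"
proof -
  have "\<forall>\<^sub>F x in at_top. \<forall>y\<ge>x. h x \<le> h y \<and> h y \<le> h x * (y / x) powr (1 / 2)"
    "\<forall>\<^sub>F x in at_top. 0 \<le> h x"
    using h by (auto simp: slowly_growing_def filterlim_at_top)
  then have "\<forall>\<^sub>F x in at_top. 0 < x \<and> 0 \<le> h x \<and> (\<forall>y\<ge>x. h y \<le> h x * (y / x) powr (1 / 2))"
    using eventually_gt_at_top[of 0] by eventually_elim auto
  then obtain x where x: "0 < x" "0 \<le> h x" "\<And>y. x \<le> y \<Longrightarrow> h y \<le> h x * (y / x) powr (1 / 2)"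
    by (auto simp: eventually_at_top_linorder)
  define c where "c = h x / sqrt x"
  have "\<forall>\<^sub>F y in at_top. 2 * c \<le> sqrt y"
    using sqrt_at_top by (auto simp: filterlim_at_top)
  then show ?thesis
    using eventually_ge_at_top[of x]
  proof eventually_elim
    case (elim y)
    have "h y \<le> c * sqrt y"
      using x elim by (auto simp: powr_half_sqrt real_sqrt_divide c_def)
    also have "\<dots> \<le> (sqrt y / 2) * sqrt y"
      using elim x by (intro mult_right_mono) auto
    also have "\<dots> = y / 2"
      using elim x by simp
    finally show ?case .
  qed
qed

text \<open>
  The function \<open>x / h x\<close> increases at speed comparable to \<open>1 / h x\<close>. For the lower bound, put
  \<open>u = sqrt x\<close> and \<open>v = sqrt y\<close>: then \<open>h y \<le> h x * (v / u)\<close>, so that the increment is at least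
  \<open>u * (v - u) / h x\<close>, and \<open>v \<le> 2 * u\<close>.
\<close>

lemma quotient_increment_bounds:
  fixes h :: "real \<Rightarrow> real"
  assumes "0 < h x" "0 < x" "x \<le> y" "y \<le> 4 * x" "h x \<le> h y" "h y \<le> h x * (y / x) powr (1 / 2)"
  shows "(y - x) / (3 * h x) \<le> y / h y - x / h x" "y / h y - x / h x \<le> (y - x) / h x"
proof -
  define u v where "u = sqrt x" and "v = sqrt y"
  have uv: "0 < u" "u \<le> v" "x = u * u" "y = v * v"
    using assms by (auto simp: u_def v_def)
  have "sqrt y \<le> sqrt (4 * x)"
    using assms by (intro real_sqrt_le_mono)
  then have "v \<le> 2 * u"
    by (simp add: u_def v_def real_sqrt_mult)
  have "h y \<le> h x * (v / u)"
    using assms by (simp add: u_def v_def powr_half_sqrt real_sqrt_divide)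
  have "(y - x) / 3 \<le> u * v - x"
  proof -
    have "u * v - x - (y - x) / 3 = (v - u) * (2 * u - v) / 3"
      using uv by (simp add: field_simps)
    moreover have "0 \<le> (v - u) * (2 * u - v)"
      using uv \<open>v \<le> 2 * u\<close> by (intro mult_nonneg_nonneg) auto
    ultimately show ?thesis
      by linarith
  qed
  then have "(y - x) / 3 / h x \<le> (u * v - x) / h x"
    using assms by (intro divide_right_mono) auto
  also have "u * v / h x = y / (h x * (v / u))"
    using uv assms by (simp add: field_simps)
  then have "(u * v - x) / h x = y / (h x * (v / u)) - x / h x"
    by (simp add: diff_divide_distrib)
  also have "y / (h x * (v / u)) \<le> y / h y"
    using assms \<open>h y \<le> h x * (v / u)\<close> uv by (intro divide_left_mono) auto
  finally show "(y - x) / (3 * h x) \<le> y / h y - x / h x"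
    by simp
  have "y / h y \<le> y / h x"
    using assms by (intro divide_left_mono) auto
  then show "y / h y - x / h x \<le> (y - x) / h x"
    by (simp add: diff_divide_distrib)
qed

section \<open>Separated sets of positive lower density\<close>

lemma lower_density_admissible_matrix_mono:
  assumes "\<And>k. 1 \<le> k \<Longrightarrow> 0 \<le> \<alpha> k" "E \<subseteq> F"
  shows "lower_density (admissible_matrix \<alpha>) E \<le> lower_density (admissible_matrix \<alpha>) F"
  unfolding lower_density_def
proof (rule Liminf_mono, rule always_eventually, rule allI)
  have "0 \<le> admissible_matrix \<alpha> n k" for n k
    using assms(1) by (auto simp: admissible_matrix_def intro!: divide_nonneg_nonneg sum_nonneg)
  then show "ereal (sum (admissible_matrix \<alpha> n) ({1..n} \<inter> E)) \<le>
      ereal (sum (admissible_matrix \<alpha> n) ({1..n} \<inter> F))" for n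
    using assms(2) by (auto intro!: sum_mono2)
qed

text \<open>
  \<open>A\<close> is a set of times and \<open>t n\<close> the type of the time \<open>n\<close>. A time of type \<open>l\<close> is at distance
  at least \<open>N l\<close> from \<open>0\<close> and from all the other times, whatever their types. The sets
  \<open>{n \<in> A. t n = l}\<close> are disjoint because \<open>t\<close> is a function.
\<close>

definition separated :: "(nat \<Rightarrow> nat) \<Rightarrow> nat set \<Rightarrow> (nat \<Rightarrow> nat) \<Rightarrow> bool"
  where "separated N A t \<longleftrightarrow> (\<forall>n\<in>A. N (t n) \<le> n) \<and>
    (\<forall>m\<in>A. \<forall>n\<in>A. m < n \<longrightarrow> m + N (t m) \<le> n \<and> m + N (t n) \<le> n)"

text \<open>
  Every value occurs with bounded gaps in the 2-adic valuations of \<open>1\<close>, \<open>2\<close>, \<open>3\<close>, \<open>...\<close>: the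
  value \<open>l\<close> is taken at the odd multiples of \<open>2 ^ l\<close>.
\<close>

lemma ruler_sequence:
  obtains \<tau> :: "nat \<Rightarrow> nat" where "\<And>l. \<exists>p. \<forall>j\<ge>p. \<exists>i<j. j \<le> i + p \<and> \<tau> i = l"
proof
  define \<tau> where "\<tau> = (\<lambda>i. multiplicity 2 (Suc i))"
  show "\<exists>p. \<forall>j\<ge>p. \<exists>i<j. j \<le> i + p \<and> \<tau> i = l" for l
  proof (rule exI[of _ "2 ^ Suc l"], intro allI impI)
    fix j :: nat assume j: "2 ^ Suc l \<le> j"
    define q where "q = (j - 2 ^ l) div 2 ^ Suc l"
    define k where "k = 2 ^ l * (2 * q + 1)"
    have k: "k = 2 ^ l + q * 2 ^ Suc l"
      by (simp add: k_def algebra_simps)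
    have qmod: "j - 2 ^ l = q * 2 ^ Suc l + (j - 2 ^ l) mod 2 ^ Suc l"
      by (simp only: q_def div_mult_mod_eq)
    have "(j - 2 ^ l) mod 2 ^ Suc l < 2 ^ Suc l"
      by simp
    moreover have "(2::nat) ^ l \<le> j"
      using j by (meson le_trans lessI less_imp_le one_le_numeral power_increasing)
    ultimately have "k \<le> j" "j < k + 2 ^ Suc l"
      using qmod k by linarith+
    moreover have "multiplicity 2 k = l"
      unfolding k_def by (rule multiplicity_decomposeI[OF refl]) auto
    moreover have "0 < k"
      by (simp add: k_def)
    ultimately show "\<exists>i<j. j \<le> i + 2 ^ Suc l \<and> \<tau> i = l"
      by (intro exI[of _ "k - 1"]) (auto simp: \<tau>_def)
  qed
qed

text \<open>
  The integers from \<open>a 0\<close> on are cut into blocks \<open>a j \<le> k < a (Suc j)\<close>, whose lengths \<open>L j\<close> are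
  nondecreasing with limit infinity and on which \<open>\<alpha>\<close> is at least \<open>w j\<close>. So the mass of a block is
  at least \<open>L j * w j\<close>; by \<open>total\<close> this is a fixed proportion of the whole mass up to the end of
  the block, and by \<open>step\<close> it grows at most geometrically with \<open>j\<close>.

  A whole block serves a single type \<open>l\<close>, given by the ruler sequence, and only if
  \<open>N l \<le> L j div 2\<close>. Its first half stays empty, which provides the distance to all earlier blocks
  since these are not longer, and its second half is filled with an arithmetic progression of
  difference \<open>N l\<close>. A used block of type \<open>l\<close> contributes at least the fraction \<open>1 / (4 * N l)\<close> of
  \<open>L j * w j\<close>. The last complete block of type \<open>l\<close> is at most \<open>p\<close> blocks back, so only a further
  factor \<open>max 1 C ^ Suc p\<close> is lost in the density.
\<close>

lemma separated_sets_of_positive_lower_density: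
  fixes \<alpha> w :: "nat \<Rightarrow> real" and a L N :: "nat \<Rightarrow> nat"
  assumes nonneg: "\<And>k. 1 \<le> k \<Longrightarrow> 0 \<le> \<alpha> k"
    and a: "strict_mono a" "1 \<le> a 0"
    and L: "\<And>j. a (Suc j) = a j + L j" "mono L" "filterlim L at_top sequentially"
    and w: "\<And>j k. a j \<le> k \<Longrightarrow> k < a (Suc j) \<Longrightarrow> w j \<le> \<alpha> k" "\<And>j. 0 < w j"
    and total: "\<And>j. (\<Sum>k=1..<a (Suc j). \<alpha> k) \<le> C * (L j * w j)"
    and step: "\<And>j. L (Suc j) * w (Suc j) \<le> C * (L j * w j)"
    and N: "\<And>l. 1 \<le> N l"
  obtains A :: "nat set" and t :: "nat \<Rightarrow> nat"
  where "separated N A t"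
    and "\<And>l. 0 < lower_density (admissible_matrix \<alpha>) {n \<in> A. t n = l}"
proof -
  obtain \<tau> :: "nat \<Rightarrow> nat" where \<tau>: "\<And>l. \<exists>p. \<forall>j\<ge>p. \<exists>i<j. j \<le> i + p \<and> \<tau> i = l"
    using ruler_sequence by blast
  \<comment> \<open>For \<open>a 0 \<le> n\<close>, this is the index of the block that contains \<open>n\<close>.\<close>
  define b where "b n = (LEAST j. n < a (Suc j))" for n
  define t where "t n = \<tau> (b n)" for n
  define A where "A = {n. a 0 \<le> n \<and> N (t n) \<le> L (b n) div 2 \<and>
    (\<exists>i. n = a (b n) + L (b n) div 2 + i * N (t n))}"
  have mono_a: "i \<le> j \<Longrightarrow> a i \<le> a j" for i j
    using a(1) by (simp add: strict_mono_less_eq)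
  have L_pos: "0 < L j" for j
    using strict_monoD[OF a(1), of j "Suc j"] L(1)[of j] by simp
  have b_eq: "b n = j" if "a j \<le> n" "n < a (Suc j)" for n j
    unfolding b_def
  proof (rule Least_equality)
    fix i assume "n < a (Suc i)"
    then have "a j < a (Suc i)" using that by simp
    then show "j \<le> i" using a(1) by (simp add: strict_mono_less)
  qed fact
  have b: "a (b n) \<le> n" "n < a (Suc (b n))" if "a 0 \<le> n" for n
  proof -
    have "n < a (Suc n)"
      using strict_mono_imp_increasing[OF a(1), of "Suc n"] by linarith
    then show "n < a (Suc (b n))"
      unfolding b_def by (rule LeastI)
    show "a (b n) \<le> n"
    proof (cases "b n")
      case (Suc j)
      then show ?thesis
        using not_less_Least[of j "\<lambda>j. n < a (Suc j)"] by (simp add: b_def not_less)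
    qed (use that in simp)
  qed
  show thesis
  proof
    have start: "N (t n) \<le> n" if "n \<in> A" for n
      using that by (auto simp: A_def)
    have "m + N (t m) \<le> n \<and> m + N (t n) \<le> n" if mn: "m \<in> A" "n \<in> A" "m < n" for m n
    proof -
      obtain i where i: "m = a (b m) + L (b m) div 2 + i * N (t m)"
        using mn by (auto simp: A_def)
      obtain k where k: "n = a (b n) + L (b n) div 2 + k * N (t n)"
        using mn by (auto simp: A_def)
      have Nle: "N (t m) \<le> L (b m) div 2" "N (t n) \<le> L (b n) div 2"
        using mn by (auto simp: A_def)
      have bm: "a (b m) \<le> m" "m < a (Suc (b m))" and bn: "a (b n) \<le> n" "n < a (Suc (b n))"
        using mn b by (auto simp: A_def)
      have "b m \<le> b n"
        using bm(1) bn(2) mn(3) strict_mono_less[OF a(1), of "b m" "Suc (b n)"] by simp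
      then consider "b m = b n" | "b m < b n"
        by linarith
      then show ?thesis
      proof cases
        case 1
        then have tt: "t m = t n"
          by (simp add: t_def)
        have "i * N (t n) < k * N (t n)"
          using i[folded 1[symmetric]] i k mn(3) 1 tt by (metis add_less_cancel_left)
        then have "Suc i * N (t n) \<le> k * N (t n)"
          using N[of "t n"] by (intro mult_right_mono) auto
        then show ?thesis
          using i k 1 tt by simp
      next
        case 2
        have "m < a (b n)"
          using bm(2) mono_a[of "Suc (b m)" "b n"] 2 by simp
        moreover have "L (b m) div 2 \<le> L (b n) div 2"
          using monoD[OF L(2), of "b m" "b n"] 2 by (intro div_le_mono) simp
        ultimately show ?thesis
          using Nle k by linarith
      qed
    qed
    with start show "separated N A t"
      by (auto simp: separated_def)
  next
    fix l
    let ?E = "{n \<in> A. t n = l}"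
    define D where "D = max 1 C"
    have block_mass: "L i * w i / (4 * N l) \<le> (\<Sum>k\<in>{a i..<a (Suc i)} \<inter> ?E. \<alpha> k)"
      if i: "\<tau> i = l" "N l \<le> L i div 2" for i
    proof -
      define x where "x = L i - L i div 2"
      define c where "c = x div N l"
      define g where "g k = a i + L i div 2 + k * N l" for k
      \<comment> \<open>Rounding down costs at most a factor \<open>2\<close>, because \<open>N l \<le> x\<close> makes the quotient positive.\<close>
      have "N l \<le> x" "L i \<le> 2 * x"
        using i by (auto simp: x_def)
      have "x < (c + 1) * N l"
        using N[of l] dividend_less_times_div[of "N l" x] by (simp add: c_def algebra_simps)
      moreover have "1 \<le> c"
        using \<open>N l \<le> x\<close> N[of l] by (simp add: c_def div_greater_zero_iff Suc_le_eq)
      then have "(c + 1) * N l \<le> (2 * c) * N l"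
        by (intro mult_right_mono) auto
      ultimately have "x < (2 * c) * N l"
        by (rule less_le_trans)
      moreover have "4 * N l * c = 2 * ((2 * c) * N l)"
        by simp
      ultimately have "L i \<le> 4 * N l * c"
        using \<open>L i \<le> 2 * x\<close> by linarith
      then have "real (L i) \<le> 4 * N l * c"
        by (metis of_nat_le_iff of_nat_mult of_nat_numeral)
      then have "L i * w i \<le> (4 * N l * c) * w i"
        using w(2)[of i] by (intro mult_right_mono) auto
      then have "L i * w i / (4 * N l) \<le> c * w i"
        using N[of l] by (simp add: pos_divide_le_eq mult_ac)
      also have "\<dots> = (\<Sum>k\<in>g ` {..<c}. w i)"
        using N[of l] by (simp add: g_def inj_on_def card_image)
      also have "\<dots> \<le> (\<Sum>k\<in>g ` {..<c}. \<alpha> k)"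
      proof (rule sum_mono)
        fix k assume "k \<in> g ` {..<c}"
        then obtain q where q: "q < c" "k = g q" by auto
        have "q * N l < c * N l" using q N[of l] by simp
        also have "c * N l \<le> x" by (simp add: c_def)
        finally have "k < a (Suc i)"
          using q L(1)[of i] by (simp add: g_def x_def)
        then show "w i \<le> \<alpha> k"
          using q by (intro w) (auto simp: g_def)
      qed
      also have "\<dots> \<le> (\<Sum>k\<in>{a i..<a (Suc i)} \<inter> ?E. \<alpha> k)"
      proof (rule sum_mono2)
        show "g ` {..<c} \<subseteq> {a i..<a (Suc i)} \<inter> ?E"
        proof safe
          fix q assume q: "q < c"
          have "q * N l < c * N l" using q N[of l] by simp
          also have "c * N l \<le> x" by (simp add: c_def)
          finally have lt: "g q < a (Suc i)"
            using q L(1)[of i] by (simp add: g_def x_def)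
          have ge: "a i \<le> g q" by (simp add: g_def)
          have bg: "b (g q) = i" using b_eq ge lt by blast
          show "g q \<in> {a i..<a (Suc i)}" using lt ge by simp
          show "t (g q) = l" using bg i by (simp add: t_def)
          then show "g q \<in> A"
            using bg i ge mono_a[of 0 i] by (auto simp: A_def g_def)
        qed
        show "0 \<le> \<alpha> k" if "k \<in> ({a i..<a (Suc i)} \<inter> ?E) - g ` {..<c}" for k
          using that a(2) mono_a[of 0 i] by (intro nonneg) auto
      qed auto
      finally show ?thesis .
    qed
    obtain p where p: "\<And>j. p \<le> j \<Longrightarrow> \<exists>i<j. j \<le> i + p \<and> \<tau> i = l"
      using \<tau>[of l] by blast
    have "\<forall>\<^sub>F i in sequentially. 2 * N l \<le> L i"
      using L(3) by (simp add: filterlim_at_top)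
    then obtain J where J: "\<And>i. J \<le> i \<Longrightarrow> 2 * N l \<le> L i"
      by (auto simp: eventually_sequentially)
    have growth: "L (i + q) * w (i + q) \<le> D ^ q * (L i * w i)" for i q
    proof (induction q)
      case (Suc q)
      have "L (i + Suc q) * w (i + Suc q) \<le> C * (L (i + q) * w (i + q))"
        using step[of "i + q"] by simp
      also have "\<dots> \<le> D * (L (i + q) * w (i + q))"
        using w(2)[of "i + q"] by (intro mult_right_mono) (auto simp: D_def)
      also have "\<dots> \<le> D * (D ^ q * (L i * w i))"
        using Suc by (intro mult_left_mono) (auto simp: D_def)
      finally show ?case by simp
    qed simp
    define \<delta> where "\<delta> = 1 / (4 * N l * D ^ Suc p)"
    have \<delta>: "0 < \<delta>"
      using N[of l] by (simp add: \<delta>_def D_def)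
    have "\<delta> \<le> (\<Sum>k\<in>{1..n} \<inter> ?E. \<alpha> k) / (\<Sum>k=1..n. \<alpha> k)" if n: "a (J + p) \<le> n" for n
    proof -
      have n0: "a 0 \<le> n"
        using n mono_a[of 0 "J + p"] by simp
      define j where "j = b n"
      have j: "a j \<le> n" "n < a (Suc j)"
        using b n0 by (auto simp: j_def)
      have "J + p \<le> j"
        using n j(2) strict_mono_less[OF a(1), of "J + p" "Suc j"] by simp
      then obtain i where i: "i < j" "j \<le> i + p" "\<tau> i = l" "J \<le> i"
        using p[of j] by auto
      have Li: "0 < L i * w i"
        using L_pos[of i] w(2)[of i] by simp
      have "L i * w i / (4 * N l) \<le> (\<Sum>k\<in>{a i..<a (Suc i)} \<inter> ?E. \<alpha> k)"
        using J[of i] i by (intro block_mass) auto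
      also have "\<dots> \<le> (\<Sum>k\<in>{1..n} \<inter> ?E. \<alpha> k)"
        using mono_a[of "Suc i" j] mono_a[of 0 i] i j a(2) nonneg
        by (intro sum_mono2) auto
      finally have num: "L i * w i / (4 * N l) \<le> (\<Sum>k\<in>{1..n} \<inter> ?E. \<alpha> k)" .
      \<comment> \<open>The total mass has to be positive, since the quotient would be \<open>0\<close> otherwise.\<close>
      have "0 < L i * w i / (4 * N l)"
        using Li N[of l] by simp
      also note num
      also have "(\<Sum>k\<in>{1..n} \<inter> ?E. \<alpha> k) \<le> (\<Sum>k=1..n. \<alpha> k)"
        using nonneg by (intro sum_mono2) auto
      finally have den_pos: "0 < (\<Sum>k=1..n. \<alpha> k)" .
      have "(\<Sum>k=1..n. \<alpha> k) \<le> (\<Sum>k=1..<a (Suc j). \<alpha> k)"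
        using j(2) nonneg by (intro sum_mono2) auto
      also have "\<dots> \<le> C * (L j * w j)"
        by (rule total)
      also have "\<dots> \<le> D * (L j * w j)"
        using w(2)[of j] by (intro mult_right_mono) (auto simp: D_def)
      also have "\<dots> \<le> D * (D ^ (j - i) * (L i * w i))"
        using growth[of i "j - i"] i by (intro mult_left_mono) (auto simp: D_def)
      also have "\<dots> = D ^ Suc (j - i) * (L i * w i)"
        by simp
      also have "\<dots> \<le> D ^ Suc p * (L i * w i)"
        using i Li by (intro mult_right_mono power_increasing) (auto simp: D_def)
      finally have den: "(\<Sum>k=1..n. \<alpha> k) \<le> D ^ Suc p * (L i * w i)" .
      have "\<delta> * (\<Sum>k=1..n. \<alpha> k) \<le> \<delta> * (D ^ Suc p * (L i * w i))"
        using den \<delta> by (intro mult_left_mono) auto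
      also have "\<dots> = L i * w i / (4 * N l)"
        by (simp add: \<delta>_def D_def)
      also note num
      finally show ?thesis
        using den_pos by (simp add: pos_le_divide_eq)
    qed
    then have "ereal \<delta> \<le> lower_density (admissible_matrix \<alpha>) ?E"
      unfolding lower_density_admissible_matrix
      by (intro Liminf_bounded) (auto simp: eventually_sequentially)
    then show "0 < lower_density (admissible_matrix \<alpha>) ?E"
      using \<delta> by (meson ereal_less(2) less_le_trans)
  qed
qed

text \<open>
  With \<open>\<phi> x = x / h x\<close>, the blocks have length about \<open>3 * h (a j)\<close>. By
  \<open>quotient_increment_bounds\<close>, \<open>\<phi>\<close> increases by at least \<open>1\<close> and at most \<open>4\<close> over a block, so the
  weights vary by a bounded factor inside a block, yet at least double from one block to the next.
  Doubling makes the mass of all earlier blocks comparable to that of the current one.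
\<close>

lemma separated_sets_for_slowly_growing:
  fixes \<alpha> :: "nat \<Rightarrow> real" and N :: "nat \<Rightarrow> nat"
  assumes nonneg: "\<And>k. 1 \<le> k \<Longrightarrow> 0 \<le> \<alpha> k"
    and \<alpha>: "\<forall>\<^sub>F k in sequentially. \<alpha> k = exp (real k / h (real k))"
    and h: "slowly_growing (1 / 2) h"
    and N: "\<And>l. 1 \<le> N l"
  obtains A :: "nat set" and t :: "nat \<Rightarrow> nat"
  where "separated N A t"
    and "\<And>l. 0 < lower_density (admissible_matrix \<alpha>) {n \<in> A. t n = l}"
proof -
  define \<phi> where "\<phi> x = x / h x" for x
  have h_lim: "filterlim h at_top at_top"
    using h by (simp add: slowly_growing_def)
  have "\<forall>\<^sub>F x in at_top. 1 \<le> h x"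
    "\<forall>\<^sub>F x in at_top. \<forall>y\<ge>x. h x \<le> h y \<and> h y \<le> h x * (y / x) powr (1 / 2)"
    using h by (auto simp: slowly_growing_def filterlim_at_top)
  then have "\<forall>\<^sub>F x in at_top. 1 \<le> x \<and> 1 \<le> h x \<and> h x \<le> x / 2 \<and>
      (\<forall>y\<ge>x. h x \<le> h y \<and> h y \<le> h x * (y / x) powr (1 / 2))"
    using slowly_growing_sublinear[OF h] eventually_ge_at_top[of 1]
    by eventually_elim simp
  then have "\<forall>\<^sub>F n in sequentially. 1 \<le> real n \<and> 1 \<le> h (real n) \<and> h (real n) \<le> real n / 2 \<and>
      (\<forall>y\<ge>real n. h (real n) \<le> h y \<and> h y \<le> h (real n) * (y / real n) powr (1 / 2))"
    by (rule eventually_compose_filterlim[OF _ filterlim_real_sequentially])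
  with \<alpha> have "\<forall>\<^sub>F n in sequentially. \<alpha> n = exp (\<phi> (real n)) \<and> 1 \<le> real n \<and> 1 \<le> h (real n) \<and>
      h (real n) \<le> real n / 2 \<and>
      (\<forall>y\<ge>real n. h (real n) \<le> h y \<and> h y \<le> h (real n) * (y / real n) powr (1 / 2))"
    by eventually_elim (auto simp: \<phi>_def)
  then obtain m0 where m0: "\<And>n. m0 \<le> n \<Longrightarrow> \<alpha> n = exp (\<phi> (real n))"
      "\<And>n. m0 \<le> n \<Longrightarrow> 1 \<le> n" "\<And>n. m0 \<le> n \<Longrightarrow> 1 \<le> h (real n)" "\<And>n. m0 \<le> n \<Longrightarrow> h (real n) \<le> real n / 2"
      "\<And>n y. m0 \<le> n \<Longrightarrow> real n \<le> y \<Longrightarrow> h (real n) \<le> h y"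
      "\<And>n y. m0 \<le> n \<Longrightarrow> real n \<le> y \<Longrightarrow> h y \<le> h (real n) * (y / real n) powr (1 / 2)"
    by (auto simp: eventually_sequentially)
  define a where "a = rec_nat m0 (\<lambda>_ n. n + nat \<lceil>3 * h (real n)\<rceil>)"
  define L where "L j = nat \<lceil>3 * h (real (a j))\<rceil>" for j
  define w where "w j = exp (\<phi> (real (a j)))" for j
  have a_Suc: "a (Suc j) = a j + L j" for j
    by (simp add: a_def L_def)
  have a_0: "a 0 = m0"
    by (simp add: a_def)
  have a_ge: "m0 \<le> a j" for j
    by (induction j) (simp_all add: a_0 a_Suc)
  note a_props = m0(2-6)[OF a_ge]
  have L_bounds: "3 * h (real (a j)) \<le> L j" "L j < 3 * h (real (a j)) + 1" for j
    using a_props(2)[of j] by (auto simp: L_def) linarith+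
  have L3: "3 \<le> L j" for j
    using L_bounds(1)[of j] a_props(2)[of j] by linarith
  have strict: "strict_mono a"
    using L3 by (simp add: strict_mono_Suc_iff a_Suc) (metis less_le_trans zero_less_numeral)
  have a_Suc_le: "real (a (Suc j)) \<le> 4 * real (a j)" for j
    using L_bounds(2)[of j] a_props(1,3)[of j] by (simp add: a_Suc)
  have monoL: "mono L"
  proof (rule incseq_SucI)
    fix j
    have "h (real (a j)) \<le> h (real (a (Suc j)))"
      by (intro a_props(4)) (simp add: a_Suc)
    then show "L j \<le> L (Suc j)"
      unfolding L_def by (intro nat_mono ceiling_mono) simp
  qed
  have increment: "(real k - real (a j)) / (3 * h (real (a j))) \<le> \<phi> (real k) - \<phi> (real (a j))"
      "\<phi> (real k) - \<phi> (real (a j)) \<le> (real k - real (a j)) / h (real (a j))"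
    if "a j \<le> k" "k \<le> a (Suc j)" for j k
  proof -
    have "real k \<le> real (a (Suc j))" using that by simp
    then have "real k \<le> 4 * real (a j)" using a_Suc_le[of j] by linarith
    then show "(real k - real (a j)) / (3 * h (real (a j))) \<le> \<phi> (real k) - \<phi> (real (a j))"
      "\<phi> (real k) - \<phi> (real (a j)) \<le> (real k - real (a j)) / h (real (a j))"
      unfolding \<phi>_def using that a_props[of j]
      by (intro quotient_increment_bounds; simp)+
  qed
  have \<phi>_ge: "\<phi> (real (a j)) \<le> \<phi> (real k)" if "a j \<le> k" "k \<le> a (Suc j)" for j k
  proof -
    have "0 \<le> (real k - real (a j)) / (3 * h (real (a j)))"
      using a_props(2)[of j] that by simp
    then show ?thesis using increment(1)[OF that] by linarith
  qed
  have \<phi>_le: "\<phi> (real k) \<le> \<phi> (real (a j)) + 4" if "a j \<le> k" "k \<le> a (Suc j)" for j k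
  proof -
    have "real k - real (a j) \<le> 3 * h (real (a j)) + 1"
      using that L_bounds(2)[of j] by (simp add: a_Suc)
    also have "\<dots> \<le> 4 * h (real (a j))"
      using a_props(2)[of j] by simp
    finally have "(real k - real (a j)) / h (real (a j)) \<le> 4"
      using a_props(2)[of j] by (simp add: pos_divide_le_eq)
    then show ?thesis using increment(2)[OF that] by linarith
  qed
  have w_pos: "0 < w j" for j
    by (simp add: w_def)
  have w_Suc_ge: "2 * w j \<le> w (Suc j)" for j
  proof -
    have "1 \<le> (real (a (Suc j)) - real (a j)) / (3 * h (real (a j)))"
      using a_props(2)[of j] L_bounds(1)[of j] by (simp add: a_Suc pos_le_divide_eq)
    then have "\<phi> (real (a j)) + 1 \<le> \<phi> (real (a (Suc j)))"
      using increment(1)[of j "a (Suc j)"] by (simp add: a_Suc)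
    then have "exp 1 * w j \<le> w (Suc j)"
      by (simp add: w_def exp_add[symmetric] add.commute)
    moreover have "2 * w j \<le> exp 1 * w j"
      using exp_ge_add_one_self[of 1] w_pos[of j] by (intro mult_right_mono) auto
    ultimately show ?thesis by simp
  qed
  have w_Suc_le: "w (Suc j) \<le> exp 4 * w j" for j
    using \<phi>_le[of j "a (Suc j)"] by (simp add: w_def exp_add[symmetric] a_Suc add.commute)
  have L_Suc_le: "real (L (Suc j)) \<le> 7 * real (L j)" for j
  proof -
    have "h (real (a (Suc j))) \<le> h (real (a j)) * (real (a (Suc j)) / real (a j)) powr (1 / 2)"
      by (intro a_props(5)) (simp add: a_Suc)
    also have "(real (a (Suc j)) / real (a j)) powr (1 / 2) \<le> 4 powr (1 / 2)"
      using a_Suc_le[of j] a_props(1)[of j] by (intro powr_mono2) (auto simp: pos_divide_le_eq)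
    also have "(4::real) powr (1 / 2) = 2"
      by (simp add: powr_half_sqrt)
    finally have "h (real (a (Suc j))) \<le> h (real (a j)) * 2"
      using a_props(2)[of j] by (simp add: mult_left_mono)
    then show ?thesis
      using L_bounds(2)[of "Suc j"] L_bounds(1)[of j] a_props(2)[of j] by linarith
  qed
  \<comment> \<open>The bound \<open>K\<close> propagates from block to block as soon as \<open>exp 4 \<le> K\<close>: the new block adds at
    most \<open>exp 4\<close>, and the doubling of \<open>w\<close> absorbs the factor \<open>2\<close> in \<open>K + exp 4 \<le> 2 * K\<close>.\<close>
  define K where "K = max (exp 4) ((\<Sum>k=1..<a 0. \<alpha> k) / (L 0 * w 0))"
  have total: "(\<Sum>k=1..<a (Suc j). \<alpha> k) \<le> (K + exp 4) * (L j * w j)"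
    if "(\<Sum>k=1..<a j. \<alpha> k) \<le> K * (L j * w j)" for j
  proof -
    have "(\<Sum>k=1..<a (Suc j). \<alpha> k) = (\<Sum>k=1..<a j. \<alpha> k) + (\<Sum>k=a j..<a (Suc j). \<alpha> k)"
      using a_props(1)[of j] by (intro sum.atLeastLessThan_concat[symmetric]) (auto simp: a_Suc)
    also have "(\<Sum>k=a j..<a (Suc j). \<alpha> k) \<le> (\<Sum>k=a j..<a (Suc j). exp 4 * w j)"
    proof (rule sum_mono)
      fix k assume k: "k \<in> {a j..<a (Suc j)}"
      then have "\<alpha> k = exp (\<phi> (real k))"
        using a_ge[of j] by (intro m0(1)) simp
      also have "\<dots> \<le> exp 4 * w j"
        using \<phi>_le[of j k] k by (simp add: w_def exp_add[symmetric] add.commute)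
      finally show "\<alpha> k \<le> exp 4 * w j" .
    qed
    also have "\<dots> = exp 4 * (L j * w j)"
      by (simp add: a_Suc)
    finally show ?thesis
      using that by (simp add: distrib_right)
  qed
  have initial: "(\<Sum>k=1..<a j. \<alpha> k) \<le> K * (L j * w j)" for j
  proof (induction j)
    case 0
    have "0 < L 0 * w 0"
      using L3[of 0] w_pos[of 0] by simp
    then show ?case
      by (simp add: K_def pos_divide_le_eq[symmetric])
  next
    case (Suc j)
    note total[OF Suc]
    also have "(K + exp 4) * (L j * w j) \<le> (2 * K) * (L j * w j)"
      using w_pos[of j] by (intro mult_right_mono) (auto simp: K_def)
    also have "\<dots> = K * (L j * (2 * w j))"
      by simp
    also have "\<dots> \<le> K * (L (Suc j) * w (Suc j))"
    proof (intro mult_left_mono mult_mono)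
      show "real (L j) \<le> real (L (Suc j))"
        using monoD[OF monoL, of j "Suc j"] by simp
      show "0 \<le> K"
        by (simp add: K_def le_max_iff_disj)
    qed (use w_Suc_ge w_pos[of j] in auto)
    finally show ?case .
  qed
  define C where "C = max (K + exp 4) (7 * exp 4)"
  show thesis
  proof (rule separated_sets_of_positive_lower_density[of \<alpha> a L w C N])
    show "filterlim L at_top sequentially"
    proof -
      have "filterlim (\<lambda>j. h (real (a j))) at_top sequentially"
        by (intro filterlim_compose[OF h_lim] filterlim_compose[OF filterlim_real_sequentially]
            filterlim_subseq strict)
      then show ?thesis
        unfolding filterlim_at_top
      proof (intro allI)
        fix Z :: nat
        assume "\<forall>Z. \<forall>\<^sub>F j in sequentially. Z \<le> h (real (a j))"
        then have "\<forall>\<^sub>F j in sequentially. real Z \<le> h (real (a j))"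
          by blast
        then show "\<forall>\<^sub>F j in sequentially. Z \<le> L j"
        proof eventually_elim
          case (elim j)
          then show ?case
            using L_bounds(1)[of j] a_props(2)[of j] by linarith
        qed
      qed
    qed
    show "w j \<le> \<alpha> k" if "a j \<le> k" "k < a (Suc j)" for j k
      using that \<phi>_ge[of j k] m0(1)[of k] a_ge[of j] by (simp add: w_def)
    show "(\<Sum>k=1..<a (Suc j). \<alpha> k) \<le> C * (L j * w j)" for j
    proof -
      have "(K + exp 4) * (L j * w j) \<le> C * (L j * w j)"
        using w_pos[of j] by (intro mult_right_mono) (auto simp: C_def)
      then show ?thesis
        using total[OF initial[of j]] by linarith
    qed
    show "L (Suc j) * w (Suc j) \<le> C * (L j * w j)" for j
    proof -
      have "L (Suc j) * w (Suc j) \<le> (7 * L j) * (exp 4 * w j)"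
        using L_Suc_le w_Suc_le w_pos[of "Suc j"] by (intro mult_mono) auto
      also have "\<dots> = (7 * exp 4) * (L j * w j)"
        by simp
      also have "\<dots> \<le> C * (L j * w j)"
        using w_pos[of j] by (intro mult_right_mono) (auto simp: C_def)
      finally show ?thesis .
    qed
    fix A :: "nat set" and t :: "nat \<Rightarrow> nat"
    assume "separated N A t"
      and "\<And>l. 0 < lower_density (admissible_matrix \<alpha>) {n \<in> A. t n = l}"
    then show thesis
      by (rule that)
  qed (use nonneg strict a_Suc monoL w_pos N m0(2)[of m0] in \<open>auto simp: a_0\<close>)
qed

section \<open>Orbits in complete seminormed groups\<close>

text \<open>
  The topology of a Frechet space in terms of an increasing sequence of seminorms, so that a single
  seminorm suffices for a basic neighbourhood. Only the additive structure is kept.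
\<close>

locale complete_seminorms =
  fixes P :: "nat \<Rightarrow> 'a::{ab_group_add, topological_space} \<Rightarrow> real"
  assumes zero: "P l 0 = 0"
    and minus: "P l (- x) = P l x"
    and triangle: "P l (x + y) \<le> P l x + P l y"
    and mono_index: "i \<le> l \<Longrightarrow> P i x \<le> P l x"
    and open_ball: "open {y. P l (y - x) < e}"
    and ball_subset: "open U \<Longrightarrow> x \<in> U \<Longrightarrow> \<exists>l. \<exists>e>0. \<forall>y. P l (y - x) < e \<longrightarrow> y \<in> U"
    and complete: "(\<And>l e. 0 < e \<Longrightarrow> \<exists>M. \<forall>m\<ge>M. \<forall>n\<ge>M. P l (X m - X n) < e) \<Longrightarrow> convergent X"
begin

lemma commute: "P l (x - y) = P l (y - x)"
  using minus[of l "x - y"] by simp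

lemma triangle_diff: "P l (x - z) \<le> P l (x - y) + P l (y - z)"
  using triangle[of l "x - y" "y - z"] by simp

lemma sum_le: "P l (sum f F) \<le> (\<Sum>k\<in>F. P l (f k))"
proof (induction F rule: infinite_finite_induct)
  case (insert k F)
  then show ?case
    using triangle[of l "f k" "sum f F"] by simp
qed (simp_all add: zero)

text \<open>
  The Cauchy criterion for unconditional convergence: finite sums over indices far out are small.
\<close>

lemma summable_tail:
  fixes f :: "nat \<Rightarrow> 'a"
  assumes "f summable_on UNIV" "0 < e"
  shows "\<exists>M. \<forall>F. finite F \<longrightarrow> (\<forall>k\<in>F. M \<le> k) \<longrightarrow> P l (sum f F) < e"
proof -
  obtain s where s: "(f has_sum s) UNIV"
    using assms by (auto simp: summable_on_def)
  have "open {y. P l (y - s) < e / 2}" "s \<in> {y. P l (y - s) < e / 2}"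
    by (rule open_ball) (use assms in \<open>simp add: zero\<close>)
  then have "\<forall>\<^sub>F F in finite_subsets_at_top UNIV. P l (sum f F - s) < e / 2"
    using s topological_tendstoD[of "sum f" s "finite_subsets_at_top UNIV" "{y. P l (y - s) < e / 2}"]
    by (simp add: has_sum_def)
  then obtain G where G: "finite G" "\<And>F. finite F \<Longrightarrow> G \<subseteq> F \<Longrightarrow> P l (sum f F - s) < e / 2"
    by (auto simp: eventually_finite_subsets_at_top)
  have "P l (sum f F) < e" if F: "finite F" "\<forall>k\<in>F. Suc (Max (insert 0 G)) \<le> k" for F
  proof -
    have "k \<notin> G" if "k \<in> F" for k
    proof
      assume "k \<in> G"
      then have "k \<le> Max (insert 0 G)"
        using G by simp
      then show False
        using F \<open>k \<in> F\<close> by force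
    qed
    then have "sum f F = sum f (F \<union> G) - sum f G"
      using F G by (subst sum.union_disjoint) auto
    moreover have "P l (sum f (F \<union> G) - s) < e / 2" "P l (s - sum f G) < e / 2"
      using F G commute[of l s] by auto
    ultimately show ?thesis
      using triangle_diff[of l "sum f (F \<union> G)" "sum f G" s] by simp
  qed
  then show ?thesis by blast
qed

text \<open>
  One threshold \<open>N l\<close> for the series with index at most \<open>l\<close>, simultaneously.
\<close>

lemma summable_uniform_tails:
  fixes f :: "nat \<Rightarrow> nat \<Rightarrow> 'a"
  assumes "\<And>\<mu>. f \<mu> summable_on UNIV" "\<And>l. 0 < e l"
  obtains N :: "nat \<Rightarrow> nat"
  where "\<And>l \<mu> F. \<mu> \<le> l \<Longrightarrow> finite F \<Longrightarrow> (\<And>k. k \<in> F \<Longrightarrow> N l \<le> k) \<Longrightarrow> P l (sum (f \<mu>) F) < e l"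
proof -
  have "\<forall>l \<mu>. \<exists>M. \<forall>F. finite F \<longrightarrow> (\<forall>k\<in>F. M \<le> k) \<longrightarrow> P l (sum (f \<mu>) F) < e l"
    using summable_tail assms by blast
  then obtain M where M: "\<And>l \<mu> F. finite F \<Longrightarrow> (\<forall>k\<in>F. M l \<mu> \<le> k) \<Longrightarrow> P l (sum (f \<mu>) F) < e l"
    by metis
  show thesis
  proof
    fix l \<mu> F
    assume *: "\<mu> \<le> l" "finite F" "\<And>k. k \<in> F \<Longrightarrow> Max (M l ` {..l}) \<le> k"
    have "M l \<mu> \<le> Max (M l ` {..l})"
      using *(1) by simp
    then show "P l (sum (f \<mu>) F) < e l"
      using M * le_trans by blast
  qed
qed

text \<open>
  A finite sum that mixes the terms of several series is small for \<open>P l\<close> if the indices are beyond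
  \<open>N l\<close> and beyond the threshold of the series they belong to. The part coming from the series
  \<open>\<mu>\<close> is estimated with \<open>P (max l \<mu>)\<close>; the exponent \<open>Suc (2 * l)\<close> in the assumption makes this
  estimate at most \<open>(1 / 2) ^ (l + Suc \<mu>)\<close>, which is summable over \<open>\<mu>\<close>.
\<close>

lemma mixed_tail_bound:
  fixes f :: "nat \<Rightarrow> nat \<Rightarrow> 'a" and t :: "nat \<Rightarrow> nat"
  assumes tails: "\<And>l \<mu> F. \<mu> \<le> l \<Longrightarrow> finite F \<Longrightarrow> (\<And>k. k \<in> F \<Longrightarrow> N l \<le> k) \<Longrightarrow>
      P l (sum (f \<mu>) F) < (1 / 2) ^ Suc (2 * l)"
    and F: "finite F" "inj_on g F" "\<And>m. m \<in> F \<Longrightarrow> N l \<le> g m" "\<And>m. m \<in> F \<Longrightarrow> N (t m) \<le> g m"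
  shows "P l (\<Sum>m\<in>F. f (t m) (g m)) \<le> (1 / 2) ^ l"
proof -
  let ?F = "\<lambda>\<mu>. {m \<in> F. t m = \<mu>}"
  have part: "P l (\<Sum>m\<in>?F \<mu>. f (t m) (g m)) \<le> (1 / 2) ^ l * (1 / 2) ^ Suc \<mu>" for \<mu>
  proof -
    have inj: "inj_on g (?F \<mu>)"
      using F by (auto intro: inj_on_subset)
    have "P l (\<Sum>m\<in>?F \<mu>. f (t m) (g m)) = P l (sum (f \<mu>) (g ` ?F \<mu>))"
      using inj by (simp add: sum.reindex)
    also have "\<dots> \<le> P (max l \<mu>) (sum (f \<mu>) (g ` ?F \<mu>))"
      by (rule mono_index) simp
    also have "\<dots> \<le> (1 / 2) ^ Suc (2 * max l \<mu>)"
    proof (rule less_imp_le, rule tails)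
      show "N (max l \<mu>) \<le> k" if "k \<in> g ` ?F \<mu>" for k
        using that F by (auto simp: max_def)
    qed (use F in auto)
    also have "\<dots> \<le> (1 / 2) ^ (l + Suc \<mu>)"
      by (intro power_decreasing) auto
    finally show ?thesis
      by (simp only: power_add)
  qed
  have "(\<Sum>m\<in>F. f (t m) (g m)) = (\<Sum>\<mu>\<in>t ` F. \<Sum>m\<in>?F \<mu>. f (t m) (g m))"
    using F by (rule_tac sum.image_gen)
  also have "P l \<dots> \<le> (\<Sum>\<mu>\<in>t ` F. P l (\<Sum>m\<in>?F \<mu>. f (t m) (g m)))"
    by (rule sum_le)
  also have "\<dots> \<le> (\<Sum>\<mu>\<in>t ` F. (1 / 2) ^ l * (1 / 2) ^ Suc \<mu>)"
    by (intro sum_mono part)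
  also have "\<dots> = (1 / 2) ^ l * (\<Sum>\<mu>\<in>t ` F. (1 / 2) ^ Suc \<mu>)"
    by (simp add: sum_distrib_left)
  also have "(\<Sum>\<mu>\<in>t ` F. (1 / 2 :: real) ^ Suc \<mu>) \<le> (\<Sum>\<mu>. (1 / 2) ^ Suc \<mu>)"
    using F power_half_series by (intro sum_le_suminf) (auto simp: sums_iff)
  also have "(\<Sum>\<mu>. (1 / 2 :: real) ^ Suc \<mu>) = 1"
    using power_half_series by (simp add: sums_iff)
  finally show ?thesis
    by simp
qed

text \<open>
  The vector \<open>z\<close> is the sum of \<open>(S ^^ m) (x (t m))\<close> over \<open>m \<in> A\<close>, in the natural order of the \<open>m\<close>;
  the partial sums are Cauchy because \<open>N (t m) \<le> m\<close> for \<open>m \<in> A\<close>. For \<open>n \<in> A\<close>, applying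
  \<open>T ^^ n\<close> turns the term with \<open>m = n\<close> into \<open>x (t n)\<close>, those with \<open>m < n\<close> into
  \<open>(T ^^ (n - m)) (x (t m))\<close>, and those with \<open>m > n\<close> into \<open>(S ^^ (m - n)) (x (t m))\<close>. The
  exponents in the last two groups are at least \<open>N (t n)\<close> and \<open>N (t m)\<close>, so each group is at most
  \<open>(1 / 2) ^ t n\<close>. The third such summand in the conclusion pays for replacing \<open>z\<close> by a partial
  sum.
\<close>

lemma orbit_follows_pattern:
  fixes T S :: "'a \<Rightarrow> 'a" and x :: "nat \<Rightarrow> 'a"
  assumes add: "\<And>y z. T (y + z) = T y + T z"
    and cont: "continuous_on UNIV T"
    and S: "S \<in> X0 \<rightarrow> X0"
    and TS: "\<forall>y\<in>X0. T (S y) = y"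
    and x: "\<And>l. x l \<in> X0"
    and sumT: "\<And>l. (\<lambda>n. (T ^^ n) (x l)) summable_on UNIV"
    and sumS: "\<And>l. (\<lambda>n. (S ^^ n) (x l)) summable_on UNIV"
  shows "\<exists>N. (\<forall>l. 1 \<le> N l) \<and> (\<forall>A t. separated N A t \<longrightarrow>
    (\<exists>z. \<forall>n\<in>A. P (t n) ((T ^^ n) z - x (t n)) < 3 * (1 / 2) ^ t n))"
proof -
  have T0: "T 0 = 0"
    using add[of 0 0] by simp
  have Tn0: "(T ^^ n) 0 = 0" for n
    by (induction n) (auto simp: T0)
  have Tn_add: "(T ^^ n) (y + z) = (T ^^ n) y + (T ^^ n) z" for n y z
    by (induction n) (auto simp: add)
  have Tn_sum: "(T ^^ n) (sum f F) = (\<Sum>k\<in>F. (T ^^ n) (f k))" for n f and F :: "nat set"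
    by (induction F rule: infinite_finite_induct) (auto simp: Tn0 Tn_add)
  have Tn_cont: "continuous_on UNIV (T ^^ n)" for n
  proof (induction n)
    case (Suc n)
    then show ?case
      using continuous_on_compose[OF Suc continuous_on_subset[OF cont]] by auto
  qed (simp add: id_def)
  have SX0: "(S ^^ n) y \<in> X0" if "y \<in> X0" for n y
    using that S by (induction n) auto
  have cancel: "(T ^^ n) ((S ^^ (n + k)) y) = (S ^^ k) y" if "y \<in> X0" for n k y
  proof (induction n)
    case (Suc n)
    then show ?case
      using bspec[OF TS SX0[OF that]] by (simp add: funpow_swap1)
  qed simp
  have cancel_le: "(T ^^ n) ((S ^^ m) y) = (T ^^ (n - m)) y" if "y \<in> X0" "m \<le> n" for n m y
    using cancel[OF that(1), of m 0] that(2) funpow_add[of "n - m" m T] by simp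
  obtain NT where NT: "\<And>l \<mu> F. \<mu> \<le> l \<Longrightarrow> finite F \<Longrightarrow> (\<And>k. k \<in> F \<Longrightarrow> NT l \<le> k) \<Longrightarrow>
      P l (\<Sum>k\<in>F. (T ^^ k) (x \<mu>)) < (1 / 2) ^ Suc (2 * l)"
    using summable_uniform_tails[of "\<lambda>\<mu> k. (T ^^ k) (x \<mu>)" "\<lambda>l. (1 / 2) ^ Suc (2 * l)"] sumT
    by auto
  obtain NS where NS: "\<And>l \<mu> F. \<mu> \<le> l \<Longrightarrow> finite F \<Longrightarrow> (\<And>k. k \<in> F \<Longrightarrow> NS l \<le> k) \<Longrightarrow>
      P l (\<Sum>k\<in>F. (S ^^ k) (x \<mu>)) < (1 / 2) ^ Suc (2 * l)"
    using summable_uniform_tails[of "\<lambda>\<mu> k. (S ^^ k) (x \<mu>)" "\<lambda>l. (1 / 2) ^ Suc (2 * l)"] sumS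
    by auto
  define N where "N l = 1 + NT l + NS l" for l
  have N_ge: "NT l \<le> N l" "NS l \<le> N l" for l
    by (simp_all add: N_def)
  have T_bound: "P l (\<Sum>m\<in>F. (T ^^ g m) (x (t m))) \<le> (1 / 2) ^ l"
    if "finite F" "inj_on g F" "\<And>m. m \<in> F \<Longrightarrow> N l \<le> g m" "\<And>m. m \<in> F \<Longrightarrow> N (t m) \<le> g m"
    for l F g and t :: "nat \<Rightarrow> nat"
  proof (rule mixed_tail_bound[of N "\<lambda>\<mu> k. (T ^^ k) (x \<mu>)" F g l t])
    show "P l (\<Sum>k\<in>F. (T ^^ k) (x \<mu>)) < (1 / 2) ^ Suc (2 * l)"
      if "\<mu> \<le> l" "finite F" "\<And>k. k \<in> F \<Longrightarrow> N l \<le> k" for l \<mu> F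
      using that(3) by (intro NT that(1,2)) (meson N_ge le_trans)
  qed (use that in auto)
  have S_bound: "P l (\<Sum>m\<in>F. (S ^^ g m) (x (t m))) \<le> (1 / 2) ^ l"
    if "finite F" "inj_on g F" "\<And>m. m \<in> F \<Longrightarrow> N l \<le> g m" "\<And>m. m \<in> F \<Longrightarrow> N (t m) \<le> g m"
    for l F g and t :: "nat \<Rightarrow> nat"
  proof (rule mixed_tail_bound[of N "\<lambda>\<mu> k. (S ^^ k) (x \<mu>)" F g l t])
    show "P l (\<Sum>k\<in>F. (S ^^ k) (x \<mu>)) < (1 / 2) ^ Suc (2 * l)"
      if "\<mu> \<le> l" "finite F" "\<And>k. k \<in> F \<Longrightarrow> N l \<le> k" for l \<mu> F
      using that(3) by (intro NS that(1,2)) (meson N_ge le_trans)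
  qed (use that in auto)
  show ?thesis
  proof (intro exI[of _ N] conjI allI impI)
    show "1 \<le> N l" for l
      by (simp add: N_def)
  next
    fix A and t :: "nat \<Rightarrow> nat"
    assume "separated N A t"
    then have A: "\<And>n. n \<in> A \<Longrightarrow> N (t n) \<le> n"
      and sep: "\<And>m n. m \<in> A \<Longrightarrow> n \<in> A \<Longrightarrow> m < n \<Longrightarrow> m + N (t m) \<le> n \<and> m + N (t n) \<le> n"
      by (auto simp: separated_def)
    define y where "y m = (S ^^ m) (x (t m))" for m
    define X where "X M = sum y (A \<inter> {..<M})" for M
    have X_le: "P l (X m - X n) \<le> (1 / 2) ^ l" if "N l \<le> n" "n \<le> m" for l m n
    proof -
      have split: "A \<inter> {..<m} = A \<inter> {..<n} \<union> A \<inter> {n..<m}"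
        using that by auto
      have "X m = X n + sum y (A \<inter> {n..<m})"
        unfolding X_def split by (rule sum.union_disjoint) auto
      then have "P l (X m - X n) = P l (\<Sum>k\<in>A \<inter> {n..<m}. (S ^^ k) (x (t k)))"
        by (simp add: y_def)
      also have "\<dots> \<le> (1 / 2) ^ l"
        using that A by (intro S_bound[where g = "\<lambda>k. k"]) auto
      finally show ?thesis .
    qed
    have "convergent X"
    proof (rule complete)
      fix i and e :: real assume "0 < e"
      then obtain k where k: "(1 / 2) ^ k < e"
        using real_arch_pow_inv[of e "1 / 2"] by auto
      define l where "l = max i k"
      have "(1 / 2 :: real) ^ l \<le> (1 / 2) ^ k" "i \<le> l"
        by (auto simp: l_def intro: power_decreasing)
      then have small: "P i (X m - X n) < e" if "N l \<le> n" "n \<le> m" for m n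
        using X_le[OF that] mono_index[of i l "X m - X n"] k by linarith
      have "P i (X m - X n) < e" if "N l \<le> m" "N l \<le> n" for m n
        using small[of n m] small[of m n] that commute[of i "X m" "X n"] by (cases "n \<le> m") auto
      then show "\<exists>M. \<forall>m\<ge>M. \<forall>n\<ge>M. P i (X m - X n) < e"
        by blast
    qed
    then obtain z where z: "X \<longlonglongrightarrow> z"
      by (auto simp: convergent_def)
    have "P (t n) ((T ^^ n) z - x (t n)) < 3 * (1 / 2) ^ t n" if n: "n \<in> A" for n
    proof -
      let ?l = "t n"
      have before: "N (t m) \<le> n - m" "N (t n) \<le> n - m" if "m \<in> A" "m < n" for m
        using sep[OF that(1) n that(2)] by linarith+
      have after: "N (t m) \<le> m - n" "N (t n) \<le> m - n" if "m \<in> A" "n < m" for m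
        using sep[OF n that] by linarith+
      have "(\<lambda>M. (T ^^ n) (X M)) \<longlonglongrightarrow> (T ^^ n) z"
        using continuous_on_tendsto_compose[OF Tn_cont z] by simp
      then have "\<forall>\<^sub>F M in sequentially. (T ^^ n) (X M) \<in> {u. P ?l (u - (T ^^ n) z) < (1 / 2) ^ ?l}"
        by (rule topological_tendstoD) (auto simp: open_ball zero)
      then have "\<forall>\<^sub>F M in sequentially. P ?l ((T ^^ n) (X M) - (T ^^ n) z) < (1 / 2) ^ ?l \<and> n < M"
        using eventually_gt_at_top[of n] by eventually_elim auto
      then obtain M where M: "P ?l ((T ^^ n) (X M) - (T ^^ n) z) < (1 / 2) ^ ?l" "n < M"
        by (auto simp: eventually_sequentially)
      have split: "A \<inter> {..<M} = insert n (A \<inter> {..<n} \<union> A \<inter> {n<..<M})"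
        using n M by auto
      have "(T ^^ n) (X M) = (T ^^ n) (y n) + ((\<Sum>m\<in>A \<inter> {..<n}. (T ^^ n) (y m)) +
          (\<Sum>m\<in>A \<inter> {n<..<M}. (T ^^ n) (y m)))"
        unfolding X_def Tn_sum split
        by (subst sum.insert) (auto intro!: sum.union_disjoint)
      moreover have "(T ^^ n) (y n) = x ?l"
        using cancel[OF x, of n 0] by (simp add: y_def)
      moreover have "P ?l (\<Sum>m\<in>A \<inter> {..<n}. (T ^^ n) (y m)) \<le> (1 / 2) ^ ?l"
      proof -
        have "(\<Sum>m\<in>A \<inter> {..<n}. (T ^^ n) (y m)) = (\<Sum>m\<in>A \<inter> {..<n}. (T ^^ (n - m)) (x (t m)))"
          by (intro sum.cong) (auto simp: y_def cancel_le x)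
        also have "P ?l \<dots> \<le> (1 / 2) ^ ?l"
          using before by (intro T_bound) (auto simp: inj_on_def)
        finally show ?thesis .
      qed
      moreover have "P ?l (\<Sum>m\<in>A \<inter> {n<..<M}. (T ^^ n) (y m)) \<le> (1 / 2) ^ ?l"
      proof -
        have "(\<Sum>m\<in>A \<inter> {n<..<M}. (T ^^ n) (y m)) =
            (\<Sum>m\<in>A \<inter> {n<..<M}. (S ^^ (m - n)) (x (t m)))"
        proof (intro sum.cong refl)
          fix m assume "m \<in> A \<inter> {n<..<M}"
          then show "(T ^^ n) (y m) = (S ^^ (m - n)) (x (t m))"
            using cancel[OF x, of n "m - n" "t m"] by (simp add: y_def)
        qed
        also have "P ?l \<dots> \<le> (1 / 2) ^ ?l"
          using after by (intro S_bound) (auto simp: inj_on_def)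
        finally show ?thesis .
      qed
      ultimately have "P ?l ((T ^^ n) (X M) - x ?l) \<le> (1 / 2) ^ ?l + (1 / 2) ^ ?l"
        using triangle[of ?l "\<Sum>m\<in>A \<inter> {..<n}. (T ^^ n) (y m)" "\<Sum>m\<in>A \<inter> {n<..<M}. (T ^^ n) (y m)"]
        by simp
      then show ?thesis
        using M triangle_diff[of ?l "(T ^^ n) z" "x ?l" "(T ^^ n) (X M)"]
          commute[of ?l "(T ^^ n) z" "(T ^^ n) (X M)"] by linarith
    qed
    then show "\<exists>z. \<forall>n\<in>A. P (t n) ((T ^^ n) z - x (t n)) < 3 * (1 / 2) ^ t n"
      by blast
  qed
qed

text \<open>
  The points \<open>x l\<close> are dense, with a prescribed radius attached to each index. The sequence \<open>d\<close>
  runs through a countable dense set and takes each value infinitely often, so that a point of the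
  open set is available with an arbitrarily large index, and the radius shrinks with the index.
\<close>

lemma exists_dense_sequence_in:
  assumes "separable_space (euclidean :: 'a topology)" "closure X0 = UNIV"
  obtains x :: "nat \<Rightarrow> 'a"
  where "\<And>l. x l \<in> X0"
    and "\<And>U. open U \<Longrightarrow> U \<noteq> {} \<Longrightarrow>
      \<exists>l. \<forall>y. P l (y - x l) < 3 * (1 / 2) ^ l \<longrightarrow> y \<in> U"
proof -
  obtain D :: "'a set" where D: "countable D" "closure D = UNIV"
    using assms(1) by (auto simp: separable_space_def)
  define d where "d l = from_nat_into D (fst (prod_decode l))" for l
  have meets: "V \<inter> E \<noteq> {}" if "open V" "V \<noteq> {}" "closure E = UNIV" for V E :: "'a set"
    using that open_Int_closure_eq_empty[of V E] by simp
  have "\<exists>y\<in>X0. P l (y - d l) < (1 / 2) ^ l" for l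
  proof -
    have "d l \<in> {y. P l (y - d l) < (1 / 2) ^ l}"
      by (simp add: zero)
    then have "{y. P l (y - d l) < (1 / 2) ^ l} \<noteq> {}"
      by blast
    from meets[OF open_ball this assms(2)] show ?thesis
      by auto
  qed
  then obtain x where x: "\<And>l. x l \<in> X0" "\<And>l. P l (x l - d l) < (1 / 2) ^ l"
    by metis
  show thesis
  proof (rule that[OF x(1)])
    fix U :: "'a set" assume U: "open U" "U \<noteq> {}"
    then obtain u where "u \<in> U" by blast
    with U obtain N e where e: "0 < e" "\<And>y. P N (y - u) < e \<Longrightarrow> y \<in> U"
      using ball_subset by meson
    have "u \<in> {y. P N (y - u) < e / 2}"
      using e by (simp add: zero)
    then have "{y. P N (y - u) < e / 2} \<noteq> {}"
      by blast
    from meets[OF open_ball this D(2)] obtain v where v: "v \<in> D" "P N (v - u) < e / 2"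
      by auto
    obtain k where k: "from_nat_into D k = v"
      using v D by (metis from_nat_into_surj)
    obtain j where j: "(1 / 2) ^ j < e / 8"
      using real_arch_pow_inv[of "e / 8" "1 / 2"] e by auto
    define l where "l = prod_encode (k, max N j)"
    have "max N j \<le> l"
      by (simp add: l_def le_prod_encode_2)
    then have l: "N \<le> l" "(1 / 2 :: real) ^ l \<le> (1 / 2) ^ j"
      by (auto intro: power_decreasing)
    have "d l = v"
      by (simp add: d_def l_def k)
    have "y \<in> U" if "P l (y - x l) < 3 * (1 / 2) ^ l" for y
    proof (rule e(2))
      have "P l (y - v) < 4 * (1 / 2) ^ l"
        using triangle_diff[of l y v "x l"] x(2)[of l] \<open>d l = v\<close> that by simp
      then have "P N (y - v) < e / 2"
        using mono_index[OF l(1), of "y - v"] l(2) j by linarith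
      then show "P N (y - u) < e"
        using triangle_diff[of N y u v] v by simp
    qed
    then show "\<exists>l. \<forall>y. P l (y - x l) < 3 * (1 / 2) ^ l \<longrightarrow> y \<in> U"
      by blast
  qed
qed

end

lemma frechet_space_imp_complete_seminorms:
  fixes smul :: "'k::real_normed_field \<Rightarrow> 'a::{ab_group_add, topological_space} \<Rightarrow> 'a"
  assumes "frechet_space smul"
  obtains P :: "nat \<Rightarrow> 'a \<Rightarrow> real" where "complete_seminorms P"
proof -
  obtain p :: "nat \<Rightarrow> 'a \<Rightarrow> real" where vs: "vector_space smul"
    and p: "\<And>i. seminorm smul (p i)"
    and top: "\<And>U. open U \<longleftrightarrow> (\<forall>x\<in>U. \<exists>N. \<exists>e>0. \<forall>y. (\<forall>i\<le>N. p i (y - x) < e) \<longrightarrow> y \<in> U)"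
    and compl: "\<And>X. (\<forall>i. \<forall>e>0. \<exists>M. \<forall>m\<ge>M. \<forall>n\<ge>M. p i (X m - X n) < e) \<Longrightarrow> convergent X"
    using assms by (auto simp: frechet_space_def)
  interpret vector_space smul by (fact vs)
  \<comment> \<open>The maximum makes \<open>P l x < e\<close> equivalent to the condition in the definition of the topology.\<close>
  define P where "P l x = Max ((\<lambda>i. p i x) ` {..l})" for l x
  have less_iff: "P l x < e \<longleftrightarrow> (\<forall>i\<le>l. p i x < e)" for l x e
    by (auto simp: P_def)
  have p_le: "p i x \<le> P l x" if "i \<le> l" for i l x
    using that by (simp add: P_def)
  have p_zero: "p i 0 = 0" and p_minus: "p i (- x) = p i x"
    and p_triangle: "p i (x + y) \<le> p i x + p i y" for i x y
  proof -
    have hom: "p i (smul c u) = norm c * p i u" for c u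
      using p[of i] by (simp add: seminorm_def)
    show "p i 0 = 0" using hom[of 0 0] by simp
    show "p i (- x) = p i x" using hom[of "-1" x] by simp
    show "p i (x + y) \<le> p i x + p i y" using p[of i] by (simp add: seminorm_def)
  qed
  have P_triangle: "P l (x + y) \<le> P l x + P l y" for l x y
  proof -
    have "p i (x + y) \<le> P l x + P l y" if "i \<le> l" for i
      using p_triangle[of i x y] p_le[OF that, of x] p_le[OF that, of y] by linarith
    then show ?thesis by (auto simp: P_def[of l "x + y"])
  qed
  show thesis
  proof
    show "complete_seminorms P"
    proof
      show "P l 0 = 0" "P l (- x) = P l x" for l x
        by (simp_all add: P_def p_zero p_minus)
      show "P l (x + y) \<le> P l x + P l y" for l x y
        by (rule P_triangle)
      show "P i x \<le> P l x" if "i \<le> l" for i l x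
        using that unfolding P_def by (intro Max_mono) auto
      show "open {y. P l (y - x) < e}" for l x e
        unfolding top
      proof
        fix y assume y: "y \<in> {y. P l (y - x) < e}"
        have "P l (z - x) < e" if "\<forall>i\<le>l. p i (z - y) < e - P l (y - x)" for z
          using that P_triangle[of l "z - y" "y - x"] less_iff[of l "z - y"] by force
        then show "\<exists>N. \<exists>d>0. \<forall>z. (\<forall>i\<le>N. p i (z - y) < d) \<longrightarrow> z \<in> {y. P l (y - x) < e}"
          using y by (intro exI[of _ l] exI[of _ "e - P l (y - x)"]) auto
      qed
      show "\<exists>l. \<exists>e>0. \<forall>y. P l (y - x) < e \<longrightarrow> y \<in> U" if "open U" "x \<in> U" for U x
        using that unfolding top less_iff by blast
      show "convergent X"
        if X: "\<And>l e. 0 < e \<Longrightarrow> \<exists>M. \<forall>m\<ge>M. \<forall>n\<ge>M. P l (X m - X n) < e" for X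
      proof (rule compl, intro allI impI)
        fix i and e :: real assume "0 < e"
        from X[OF this, of i] show "\<exists>M. \<forall>m\<ge>M. \<forall>n\<ge>M. p i (X m - X n) < e"
          unfolding less_iff by blast
      qed
    qed
  qed
qed

section \<open>Frequent hypercyclicity\<close>

theorem theorem4p12:
  fixes smul :: "'k::real_normed_field \<Rightarrow> 'a::{ab_group_add, topological_space} \<Rightarrow> 'a"
    and T S :: "'a \<Rightarrow> 'a"
    and X0 :: "'a set"
  assumes "frechet_space smul"
    and "separable_space (euclidean :: 'a topology)"
    and "Vector_Spaces.linear smul smul T"
    and "continuous_on UNIV T"
    and "closure X0 = UNIV"
    and "S \<in> X0 \<rightarrow> X0"
    and "\<And>x. x \<in> X0 \<Longrightarrow> (\<lambda>n::nat. (T ^^ n) x) summable_on UNIV"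
    and "\<And>x. x \<in> X0 \<Longrightarrow> (\<lambda>n::nat. (S ^^ n) x) summable_on UNIV"
    and "\<And>x. x \<in> X0 \<Longrightarrow> T (S x) = x"
  shows "\<forall>s\<ge>2. \<forall>B. is_B_tilde s B \<longrightarrow> frequently_hypercyclic B T"
proof (intro allI impI)
  fix s :: nat and B assume s: "2 \<le> s" and "is_B_tilde s B"
  then obtain \<alpha> where \<alpha>: "admissible_weights \<alpha>"
      "\<forall>\<^sub>F k in sequentially. \<alpha> k = exp (real k / h_fun s (real k))"
    and B: "B = admissible_matrix \<alpha>"
    by (auto simp: is_B_tilde_def)
  have \<alpha>_nonneg: "0 \<le> \<alpha> k" if "1 \<le> k" for k
    using \<alpha>(1) that by (simp add: admissible_weights_def)
  have h: "slowly_growing (1 / 2) (h_fun s)"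
    using s by (intro slowly_growing_h_fun) simp
  obtain P :: "nat \<Rightarrow> 'a \<Rightarrow> real" where "complete_seminorms P"
    using frechet_space_imp_complete_seminorms[OF assms(1)] by blast
  then interpret complete_seminorms P .
  have add: "T (y + z) = T y + T z" for y z
    using assms(3) by (rule Vector_Spaces.linear.axioms(3)[THEN module_hom.add])
  have TS: "\<forall>y\<in>X0. T (S y) = y"
    using assms(9) by blast
  obtain x :: "nat \<Rightarrow> 'a" where x: "\<And>l. x l \<in> X0"
    and dense: "\<And>U. open U \<Longrightarrow> U \<noteq> {} \<Longrightarrow>
      \<exists>l. \<forall>y. P l (y - x l) < 3 * (1 / 2) ^ l \<longrightarrow> y \<in> U"
    using exists_dense_sequence_in[OF assms(2,5)] by blast
  obtain N :: "nat \<Rightarrow> nat" where N: "\<And>l. 1 \<le> N l"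
    and orbit: "\<And>A t. separated N A t \<Longrightarrow>
      \<exists>z. \<forall>n\<in>A. P (t n) ((T ^^ n) z - x (t n)) < 3 * (1 / 2) ^ t n"
    using orbit_follows_pattern[where x = x, OF add assms(4,6) TS x assms(7)[OF x] assms(8)[OF x]]
    by (elim exE conjE) blast
  obtain A t where A: "separated N A t"
    and density: "\<And>l. 0 < lower_density (admissible_matrix \<alpha>) {n \<in> A. t n = l}"
    by (rule separated_sets_for_slowly_growing[where N = N, OF \<alpha>_nonneg \<alpha>(2) h N])
      (assumption, rule that, blast+)
  obtain z where z: "\<And>n. n \<in> A \<Longrightarrow> P (t n) ((T ^^ n) z - x (t n)) < 3 * (1 / 2) ^ t n"
    using orbit[OF A] by blast
  show "frequently_hypercyclic B T"
    unfolding frequently_hypercyclic_def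
  proof (intro exI[of _ z] allI impI, elim conjE)
    fix U :: "'a set" assume "open U" "U \<noteq> {}"
    then obtain l where l: "\<And>y. P l (y - x l) < 3 * (1 / 2) ^ l \<Longrightarrow> y \<in> U"
      using dense by blast
    have "{n \<in> A. t n = l} \<subseteq> {n. n \<ge> 1 \<and> (T ^^ n) z \<in> U}"
    proof safe
      fix n assume "n \<in> A" "l = t n"
      then show "1 \<le> n"
        using A N[of "t n"] by (auto simp: separated_def intro: le_trans)
      show "(T ^^ n) z \<in> U"
        using \<open>n \<in> A\<close> \<open>l = t n\<close> z[of n] l by simp
    qed
    then have "lower_density B {n \<in> A. t n = l} \<le> lower_density B {n. n \<ge> 1 \<and> (T ^^ n) z \<in> U}"
      unfolding B by (intro lower_density_admissible_matrix_mono \<alpha>_nonneg)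
    with density[of l, folded B] show "0 < lower_density B {n. n \<ge> 1 \<and> (T ^^ n) z \<in> U}"
      by (rule less_le_trans)
  qed
qed

end
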